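(* Let $r$ be a rational function with $\deg(r)\ge 2$ such that $f(z)=r(z)-\overline{z}$ is non-degenerate and $\lim_{|z|\to\infty}|f(z)|=\infty$. If $\eta_1,\eta_2\in\mathbb{C}$ are linked by a continuous path that does not cross a caustic of $f$, i.e. there is a continuous $\psi:[0,1]\to\mathbb{C}$ with $\psi(0)=\eta_1$, $\psi(1)=\eta_2$ and $\psi([0,1])\cap f(\mathcal{C})=\emptyset$, then $N(f_{\eta_1};A)=N(f_{\eta_2};A)$ holds for each set $A\in\mathcal{A}$, and $N(f_{\eta_1})=N(f_{\eta_2})$.
   Context: For $f(z)=r(z)-\overline{z}$ with $r=p/q$ rational ($p,q$ coprime polynomials), $\deg(r)=\max(\deg p,\deg q)$. The set of critical points of $f$ is $\mathcal{C}=\{z\in\mathbb{C}:|r'(z)|=1\}$. $f$ is called non-degenerate if $r''(z)\ne 0$ for all $z\in\mathcal{C}$; then $\mathcal{C}$ consists of finitely many pairwise disjoint smooth closed Jordan curves (the critical curves). $\mathcal{A}$ denotes the (finite) set of connected components of $\mathbb{C}\setminus\mathcal{C}$. The caustics of $f$ are the images $f(\Gamma)$ of the critical curves $\Gamma$, and $f(\mathcal{C})$ is the set of caustic points. For $\eta\in\mathbb{C}$, $f_\eta(z):=f(z)-\eta$. $N(g;A)$ is the number of zeros of $g$ in $A\subseteq\mathbb{C}$, and $N(g):=N(g;\mathbb{C})$. *)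

theory Defs
  imports
    "HOL-Analysis.Analysis"
    "HOL-Computational_Algebra.Polynomial"
    "HOL-Library.Extended_Nat"
begin

definition rat_fun :: "complex poly \<Rightarrow> complex poly \<Rightarrow> complex \<Rightarrow> complex" where
  "rat_fun p q z = poly p z / poly q z"

text \<open>Since \<open>x / 0 = 0\<close>, \<open>rat_fun p q\<close> takes a spurious value at the zeros of \<open>q\<close>. Everything below
  is therefore restricted to the following domain; for coprime \<open>p\<close> and \<open>q\<close> it is the complement of
  the set of poles.\<close>

definition rat_dom :: "complex poly \<Rightarrow> complex set" where
  "rat_dom q = {z. poly q z \<noteq> 0}"

text \<open>This is the degree of the rational function only if \<open>p\<close> and \<open>q\<close> are coprime.\<close>

definition rat_degree :: "complex poly \<Rightarrow> complex poly \<Rightarrow> nat" where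
  "rat_degree p q = max (degree p) (degree q)"

definition harm_map :: "complex poly \<Rightarrow> complex poly \<Rightarrow> complex \<Rightarrow> complex" where
  "harm_map p q z = rat_fun p q z - cnj z"

definition harm_shift :: "complex poly \<Rightarrow> complex poly \<Rightarrow> complex \<Rightarrow> complex \<Rightarrow> complex" where
  "harm_shift p q \<eta> z = harm_map p q z - \<eta>"

definition crit_set :: "complex poly \<Rightarrow> complex poly \<Rightarrow> complex set" where
  "crit_set p q = {z \<in> rat_dom q. cmod (deriv (rat_fun p q) z) = 1}"

definition nondegenerate :: "complex poly \<Rightarrow> complex poly \<Rightarrow> bool" where
  "nondegenerate p q \<longleftrightarrow> (\<forall>z \<in> crit_set p q. deriv (deriv (rat_fun p q)) z \<noteq> 0)"

definition caustic_points :: "complex poly \<Rightarrow> complex poly \<Rightarrow> complex set" where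
  "caustic_points p q = harm_map p q ` crit_set p q"

text \<open>The components are taken in the whole plane, so they may contain poles.\<close>

definition crit_components :: "complex poly \<Rightarrow> complex poly \<Rightarrow> complex set set" where
  "crit_components p q = components (UNIV - crit_set p q)"

text \<open>The number of zeros in \<open>A\<close> of a function \<open>g\<close> with domain \<open>D\<close>, counted without multiplicity.
  It is \<open>enat\<close>-valued because \<open>card\<close> is \<open>0\<close> on infinite sets.\<close>

definition num_zeros :: "complex set \<Rightarrow> (complex \<Rightarrow> complex) \<Rightarrow> complex set \<Rightarrow> enat" where
  "num_zeros D g A =
     (let Z = {z \<in> A \<inter> D. g z = 0} in if finite Z then enat (card Z) else \<infinity>)"

end

theory Submission
  imports Defs "HOL-Complex_Analysis.Complex_Analysis"
begin

text \<open>
  Off the critical set, \<open>f\<close> is locally injective, because the conjugation changes lengths by the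
  factor \<open>1\<close> and \<open>r\<close> by a factor close to \<open>\<bar>r'\<bar> \<noteq> 1\<close>; by invariance of domain it is a local
  homeomorphism there. As \<open>f\<close> tends to infinity at the poles and at infinity, it is proper on its
  domain. Since the path avoids the caustics, its preimage is a compact set that misses the critical
  set, and so is the part of this preimage in any component. A local homeomorphism
  has locally constant fibre cardinality over a connected set whose preimage is compact.
\<close>

section \<open>Fibres of local homeomorphisms\<close>

lemma finite_fibre_if_locally_injective:
  fixes f :: "'a::metric_space \<Rightarrow> 'b"
  assumes comp: "compact {x \<in> S. f x = y}"
    and inj: "\<And>x. x \<in> S \<Longrightarrow> \<exists>e>0. inj_on f (ball x e)"
  shows "finite {x \<in> S. f x = y}"
proof -
  let ?F = "{x \<in> S. f x = y}"
  have "\<not> x islimpt ?F" if x: "x \<in> ?F" for x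
  proof
    assume lim: "x islimpt ?F"
    obtain e where e: "e > 0" "inj_on f (ball x e)"
      using inj x by blast
    then obtain x' where "x' \<in> ?F" "x' \<in> ball x e" "x' \<noteq> x"
      using lim unfolding islimpt_def by (metis centre_in_ball open_ball)
    then show False
      using e x by (auto simp: inj_on_def)
  qed
  then have "finite (?F \<inter> ?F)"
    by (rule finite_not_islimpt_in_compact[OF comp])
  then show ?thesis by simp
qed

text \<open>Small disjoint balls around the points of the fibre over \<open>y\<close> each
  contribute exactly one preimage of a nearby \<open>y'\<close>. Compactness keeps the image of the
  rest of the preimage of \<open>T\<close> away from \<open>y\<close>, so no further preimages
  appear as long as \<open>y'\<close> stays in \<open>T\<close>.\<close>

lemma card_fibre_locally_constant:
  fixes f :: "'a::euclidean_space \<Rightarrow> 'a"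
  assumes contf: "continuous_on S f"
    and inj: "\<And>x. x \<in> S \<Longrightarrow> \<exists>e>0. ball x e \<subseteq> S \<and> inj_on f (ball x e)"
    and comp: "compact {x \<in> S. f x \<in> T}"
    and fin: "finite {x \<in> S. f x = y}"
  shows "\<exists>W. open W \<and> y \<in> W \<and> (\<forall>y' \<in> T \<inter> W. card {x \<in> S. f x = y'} = card {x \<in> S. f x = y})"
proof -
  let ?F = "{x \<in> S. f x = y}" and ?K = "{x \<in> S. f x \<in> T}"
  have "\<forall>x\<in>?F. \<exists>e>0. ball x e \<subseteq> S \<and> inj_on f (ball x e)"
    using inj by blast
  then obtain e where e: "\<And>x. x \<in> ?F \<Longrightarrow> e x > 0 \<and> ball x (e x) \<subseteq> S \<and> inj_on f (ball x (e x))"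
    by metis
  \<comment> \<open>The inserted \<open>1\<close> keeps \<open>Min\<close> meaningful when the fibre
    is empty. The halving puts fibre points whose \<open>d\<close>-balls meet within each other's
    balls of injectivity.\<close>
  define d where "d = Min (insert 1 (e ` ?F)) / 2"
  have "d > 0"
    using fin e by (auto simp: d_def)
  have d_le: "2 * d \<le> e x" if "x \<in> ?F" for x
    using fin that by (auto simp: d_def intro!: Min_le)
  have sub: "ball x d \<subseteq> ball x (e x)" if "x \<in> ?F" for x
    using d_le[OF that] \<open>d > 0\<close> by auto
  have ball_S: "ball x d \<subseteq> S" and inj_ball: "inj_on f (ball x d)" if "x \<in> ?F" for x
    using e[OF that] sub[OF that] by (auto intro: inj_on_subset)
  \<comment> \<open>Two points of the fibre have the same image, so neither lies in the ball of injectivity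
    around the other.\<close>
  have disj: "x = x'" if "x \<in> ?F" "x' \<in> ?F" "u \<in> ball x d" "u \<in> ball x' d" for x x' u
  proof -
    have "dist x x' < 2 * d"
      using that dist_triangle_less_add[of x u d x' d] by (simp add: dist_commute)
    then have "x' \<in> ball x (e x)" "x \<in> ball x (e x)"
      using d_le[OF that(1)] e[OF that(1)] by auto
    moreover have "inj_on f (ball x (e x))" "f x = f x'"
      using e[OF that(1)] that by auto
    ultimately show ?thesis
      by (auto simp: inj_on_def)
  qed
  define R where "R = ?K - (\<Union>x\<in>?F. ball x d)"
  have "compact R"
    unfolding R_def by (intro compact_diff comp open_UN ballI open_ball)
  moreover have "continuous_on R f"
    using contf by (rule continuous_on_subset) (auto simp: R_def)
  ultimately have "closed (f ` R)"
    by (simp add: compact_continuous_image compact_imp_closed)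
  define W where "W = (\<Inter>x\<in>?F. f ` ball x d) - f ` R"
  have "open (f ` ball x d)" if "x \<in> ?F" for x
    by (intro invariance_of_domain continuous_on_subset[OF contf ball_S] inj_ball that open_ball)
  then have "open (\<Inter>x\<in>?F. f ` ball x d)"
    using fin by (intro open_INT) auto
  then have "open W"
    unfolding W_def using \<open>closed (f ` R)\<close> by (rule open_Diff)
  moreover have "y \<in> W"
  proof -
    have "y \<in> f ` ball x d" if "x \<in> ?F" for x
      using that \<open>d > 0\<close> by (intro image_eqI[of _ _ x]) auto
    moreover have "y \<notin> f ` R"
      using \<open>d > 0\<close> by (force simp: R_def)
    ultimately show ?thesis by (auto simp: W_def)
  qed
  moreover have "card {x \<in> S. f x = y'} = card ?F" if y': "y' \<in> T \<inter> W" for y'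
  proof -
    have "\<forall>x\<in>?F. \<exists>u. u \<in> ball x d \<and> f u = y'"
      using y' unfolding W_def by blast
    then obtain g where g: "\<And>x. x \<in> ?F \<Longrightarrow> g x \<in> ball x d \<and> f (g x) = y'"
      by metis
    have "inj_on g ?F"
      using disj g by (metis (no_types, lifting) inj_onI)
    moreover have "g ` ?F = {x \<in> S. f x = y'}"
    proof (intro equalityI subsetI)
      fix u assume "u \<in> g ` ?F"
      then show "u \<in> {x \<in> S. f x = y'}"
        using g ball_S by blast
    next
      fix u assume u: "u \<in> {x \<in> S. f x = y'}"
      then have "u \<notin> R"
        using y' by (auto simp: W_def)
      then obtain x where x: "x \<in> ?F" "u \<in> ball x d"
        using u y' by (auto simp: R_def)
      then have "u = g x"
        using g[OF x(1)] inj_ball[OF x(1)] u unfolding inj_on_def by blast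
      then show "u \<in> g ` ?F"
        using x by blast
    qed
    ultimately show ?thesis
      using card_image[of g ?F] by simp
  qed
  ultimately show ?thesis by blast
qed

lemma card_fibre_constant:
  fixes f :: "'a::euclidean_space \<Rightarrow> 'a"
  assumes contf: "continuous_on S f"
    and inj: "\<And>x. x \<in> S \<Longrightarrow> \<exists>e>0. ball x e \<subseteq> S \<and> inj_on f (ball x e)"
    and comp: "compact {x \<in> S. f x \<in> T}"
    and "connected T" "a \<in> T" "b \<in> T"
  shows "finite {x \<in> S. f x = a}"
    and "card {x \<in> S. f x = a} = card {x \<in> S. f x = b}"
proof -
  have fin: "finite {x \<in> S. f x = y}" if "y \<in> T" for y
  proof (rule finite_fibre_if_locally_injective)
    \<comment> \<open>\<open>S\<close> need not be closed, so the fibre is shown to be closed inside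
      the compact preimage of \<open>T\<close> instead.\<close>
    have "continuous_on {x \<in> S. f x \<in> T} f"
      using contf by (rule continuous_on_subset) auto
    then have "closed ({x \<in> S. f x \<in> T} \<inter> f -` {y})"
      using comp by (intro continuous_closed_preimage compact_imp_closed) auto
    then have "compact ({x \<in> S. f x \<in> T} \<inter> ({x \<in> S. f x \<in> T} \<inter> f -` {y}))"
      by (rule compact_Int_closed[OF comp])
    also have "{x \<in> S. f x \<in> T} \<inter> ({x \<in> S. f x \<in> T} \<inter> f -` {y}) = {x \<in> S. f x = y}"
      using that by auto
    finally show "compact {x \<in> S. f x = y}" .
    show "\<exists>e>0. inj_on f (ball x e)" if "x \<in> S" for x
      using inj[OF that] by blast
  qed
  then show "finite {x \<in> S. f x = a}"
    using assms by blast
  have "(\<lambda>y. card {x \<in> S. f x = y}) constant_on T"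
  proof (rule locally_constant_imp_constant[OF \<open>connected T\<close>])
    fix y assume "y \<in> T"
    then obtain W where "open W" "y \<in> W"
      "\<forall>y' \<in> T \<inter> W. card {x \<in> S. f x = y'} = card {x \<in> S. f x = y}"
      using card_fibre_locally_constant[OF contf inj comp fin] by blast
    then show "\<exists>V. openin (top_of_set T) V \<and> y \<in> V \<and>
        (\<forall>y'\<in>V. card {x \<in> S. f x = y'} = card {x \<in> S. f x = y})"
      using \<open>y \<in> T\<close> openin_open_Int by (intro exI[of _ "T \<inter> W"]) blast
  qed
  then show "card {x \<in> S. f x = a} = card {x \<in> S. f x = b}"
    using assms by (auto simp: constant_on_def)
qed

section \<open>Local injectivity off the critical set\<close>

lemma holomorphic_minus_cnj_locally_injective:
  assumes holo: "g holomorphic_on D" and D: "open D" and z: "z \<in> D"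
    and ne: "cmod (deriv g z) \<noteq> 1"
  shows "\<exists>e>0. inj_on (\<lambda>w. g w - cnj w) (ball z e)"
proof -
  let ?c = "deriv g z"
  \<comment> \<open>Half the gap between \<open>cmod ?c\<close> and \<open>1\<close>: the linear
    part \<open>cnj h - ?c * h\<close> has modulus at least \<open>2 * \<epsilon> * cmod h\<close>,
    which beats an error of at most \<open>\<epsilon> * cmod h\<close>.\<close>
  define \<epsilon> where "\<epsilon> = \<bar>cmod ?c - 1\<bar> / 2"
  have "\<epsilon> > 0" using ne by (simp add: \<epsilon>_def)
  have "isCont (deriv g) z"
    using holomorphic_on_imp_continuous_on[OF holomorphic_deriv[OF holo D]] D z
    by (simp add: continuous_on_eq_continuous_at)
  then obtain d where d: "d > 0" "\<And>w. dist w z < d \<Longrightarrow> dist (deriv g w) ?c < \<epsilon>"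
    using \<open>\<epsilon> > 0\<close> unfolding continuous_at_eps_delta by blast
  obtain d' where d': "d' > 0" "ball z d' \<subseteq> D"
    using D z open_contains_ball by blast
  define e where "e = min d d'"
  have "e > 0" using d d' by (simp add: e_def)
  have close: "cmod ((g a - ?c * a) - (g b - ?c * b)) \<le> \<epsilon> * cmod (a - b)"
    if "a \<in> ball z e" "b \<in> ball z e" for a b
  proof (rule field_differentiable_bound[where S = "ball z e" and f' = "\<lambda>w. deriv g w - ?c"])
    fix w assume w: "w \<in> ball z e"
    then have "w \<in> D" using d' by (auto simp: e_def)
    then have "(g has_field_derivative deriv g w) (at w within ball z e)"
      using holomorphic_derivI[OF holo D] by blast
    then show "((\<lambda>w. g w - ?c * w) has_field_derivative deriv g w - ?c) (at w within ball z e)"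
      by (intro DERIV_diff DERIV_cmult_Id)
    show "cmod (deriv g w - ?c) \<le> \<epsilon>"
      using d(2)[of w] w by (simp add: e_def dist_norm norm_minus_commute)
  qed (use that in auto)
  have "inj_on (\<lambda>w. g w - cnj w) (ball z e)"
  proof (rule inj_onI, rule ccontr)
    fix a b assume ab: "a \<in> ball z e" "b \<in> ball z e" "g a - cnj a = g b - cnj b" "a \<noteq> b"
    \<comment> \<open>Equal images mean \<open>g a - g b = cnj (a - b)\<close>, which turns the
      linearization error into the linear part itself.\<close>
    have "(g a - ?c * a) - (g b - ?c * b) = cnj (a - b) - ?c * (a - b)"
      using ab(3) by (simp add: algebra_simps)
    then have "cmod (cnj (a - b) - ?c * (a - b)) \<le> \<epsilon> * cmod (a - b)"
      using close[OF ab(1,2)] by metis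
    moreover have "\<bar>cmod (cnj (a - b)) - cmod (?c * (a - b))\<bar> \<le> cmod (cnj (a - b) - ?c * (a - b))"
      by (rule norm_triangle_ineq3)
    moreover have "\<bar>cmod (cnj (a - b)) - cmod (?c * (a - b))\<bar> = 2 * \<epsilon> * cmod (a - b)"
    proof -
      have "cmod (cnj (a - b)) - cmod (?c * (a - b)) = (1 - cmod ?c) * cmod (a - b)"
        unfolding complex_mod_cnj norm_mult by (simp add: algebra_simps)
      then show ?thesis by (simp add: abs_mult \<epsilon>_def abs_minus_commute)
    qed
    ultimately have "2 * \<epsilon> * cmod (a - b) \<le> \<epsilon> * cmod (a - b)"
      by linarith
    then show False
      using \<open>\<epsilon> > 0\<close> \<open>a \<noteq> b\<close> by simp
  qed
  then show ?thesis using \<open>e > 0\<close> by blast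
qed

section \<open>Continuity and properness of the harmonic map on its domain\<close>

lemma open_rat_dom: "open (rat_dom q)"
  unfolding rat_dom_def by (intro open_Collect_neq continuous_intros)

lemma rat_fun_holomorphic: "rat_fun p q holomorphic_on rat_dom q"
  unfolding rat_fun_def[abs_def] rat_dom_def by (intro holomorphic_intros) auto

lemma continuous_on_harm_map: "continuous_on (rat_dom q) (harm_map p q)"
  unfolding harm_map_def[abs_def]
  by (intro continuous_intros holomorphic_on_imp_continuous_on rat_fun_holomorphic)

lemma open_rat_dom_minus_crit: "open (rat_dom q - crit_set p q)"
proof -
  have "continuous_on (rat_dom q) (\<lambda>z. cmod (deriv (rat_fun p q) z))"
    using holomorphic_deriv[OF rat_fun_holomorphic open_rat_dom]
    by (intro continuous_intros holomorphic_on_imp_continuous_on)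
  then have "open (rat_dom q \<inter> (\<lambda>z. cmod (deriv (rat_fun p q) z)) -` (- {1}))"
    by (intro continuous_open_preimage open_rat_dom) auto
  also have "rat_dom q \<inter> (\<lambda>z. cmod (deriv (rat_fun p q) z)) -` (- {1}) = rat_dom q - crit_set p q"
    by (auto simp: crit_set_def)
  finally show ?thesis .
qed

text \<open>Growth at infinity bounds the preimage. For closedness, the point to settle is that
  preimage points cannot accumulate at a pole.\<close>

lemma compact_harm_map_preimage:
  assumes "coprime p q"
    and lim: "filterlim (\<lambda>z. cmod (harm_map p q z)) at_top at_infinity"
    and T: "compact T"
  shows "compact {z \<in> rat_dom q. harm_map p q z \<in> T}"
proof -
  let ?K = "{z \<in> rat_dom q. harm_map p q z \<in> T}"
  obtain M where M: "\<And>w. w \<in> T \<Longrightarrow> cmod w \<le> M"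
    using compact_imp_bounded[OF T] by (auto simp: bounded_iff)
  \<comment> \<open>The extra \<open>1\<close> contradicts the bound \<open>M\<close> on
    \<open>T\<close>, so points with \<open>cmod z \<ge> B\<close> lie outside the preimage.\<close>
  have "\<forall>\<^sub>F z in at_infinity. M + 1 \<le> cmod (harm_map p q z)"
    using lim by (simp add: filterlim_at_top)
  then obtain B where B: "\<And>z. cmod z \<ge> B \<Longrightarrow> M + 1 \<le> cmod (harm_map p q z)"
    by (auto simp: eventually_at_infinity)
  have bound: "cmod z \<le> B" if "z \<in> ?K" for z
    using M[of "harm_map p q z"] B[of z] that by (cases "cmod z \<ge> B") auto
  have "closed ?K"
    unfolding closed_sequential_limits
  proof (intro allI impI, elim conjE)
    fix x l assume x: "\<forall>n. x n \<in> ?K" and l: "x \<longlonglongrightarrow> l"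
    have poly_lim: "(\<lambda>n. poly h (x n)) \<longlonglongrightarrow> poly h l" for h
      using l by (intro tendsto_intros)
    \<comment> \<open>With the denominator cleared, the inequality survives the limit. If
      \<open>l\<close> were a zero of \<open>q\<close>, it would then be a zero of \<open>p\<close>
      too, against coprimality.\<close>
    have "cmod (poly p (x n)) \<le> cmod (poly q (x n)) * (M + B)" for n
    proof -
      have "poly q (x n) \<noteq> 0" "harm_map p q (x n) \<in> T" "x n \<in> ?K"
        using x by (auto simp: rat_dom_def)
      have "poly p (x n) = poly q (x n) * (harm_map p q (x n) + cnj (x n))"
        using \<open>poly q (x n) \<noteq> 0\<close> by (simp add: harm_map_def rat_fun_def)
      moreover have "cmod (harm_map p q (x n) + cnj (x n)) \<le> M + B"
        using M[OF \<open>harm_map p q (x n) \<in> T\<close>] bound[OF \<open>x n \<in> ?K\<close>]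
        by (intro norm_triangle_le) simp
      ultimately show ?thesis
        by (metis norm_mult mult_left_mono norm_ge_zero)
    qed
    then have "cmod (poly p l) \<le> cmod (poly q l) * (M + B)"
      by (intro LIMSEQ_le[OF tendsto_norm[OF poly_lim]
            tendsto_mult[OF tendsto_norm[OF poly_lim] tendsto_const]]) auto
    then have "l \<in> rat_dom q"
      using coprime_poly_0[OF \<open>coprime p q\<close>, of l] by (auto simp: rat_dom_def)
    then have "isCont (harm_map p q) l"
      using continuous_on_harm_map open_rat_dom continuous_on_eq_continuous_at by blast
    then have lim_f: "(\<lambda>n. harm_map p q (x n)) \<longlonglongrightarrow> harm_map p q l"
      using l by (rule isCont_tendsto_compose)
    have "harm_map p q l \<in> T"
      by (rule closed_sequentially[OF compact_imp_closed[OF T] _ lim_f]) (use x in blast)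
    then show "l \<in> ?K" using \<open>l \<in> rat_dom q\<close> by blast
  qed
  then show ?thesis
    using bound by (auto simp: compact_eq_bounded_closed bounded_iff)
qed

section \<open>Counting zeros along the path\<close>

text \<open>Serves both claims, with \<open>A\<close> a component or the whole plane.
  \<open>S\<close> is \<open>A\<close> without poles and critical points, and \<open>zeros\<close>
  ensures that no zero is lost in passing to it.\<close>

lemma num_zeros_harm_shift_eq:
  assumes "S \<subseteq> rat_dom q - crit_set p q" and S: "open S"
    and "compact {z \<in> S. harm_map p q z \<in> T}" and "connected T" and "a \<in> T" "b \<in> T"
    and zeros: "\<And>\<eta> z. \<eta> \<in> T \<Longrightarrow> z \<in> A \<inter> rat_dom q \<Longrightarrow> harm_map p q z = \<eta> \<Longrightarrow> z \<in> S"
    and "S \<subseteq> A"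
  shows "num_zeros (rat_dom q) (harm_shift p q a) A = num_zeros (rat_dom q) (harm_shift p q b) A"
proof -
  have cont: "continuous_on S (harm_map p q)"
    using assms(1) by (intro continuous_on_subset[OF continuous_on_harm_map]) auto
  have inj: "\<exists>e>0. ball z e \<subseteq> S \<and> inj_on (harm_map p q) (ball z e)" if z: "z \<in> S" for z
  proof -
    have "z \<in> rat_dom q" "cmod (deriv (rat_fun p q) z) \<noteq> 1"
      using z assms(1) by (auto simp: crit_set_def)
    then obtain e where e: "e > 0" "inj_on (harm_map p q) (ball z e)"
      using holomorphic_minus_cnj_locally_injective[OF rat_fun_holomorphic open_rat_dom]
      unfolding harm_map_def[abs_def] by blast
    obtain e' where e': "e' > 0" "ball z e' \<subseteq> S"
      using S z open_contains_ball by blast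
    have "inj_on (harm_map p q) (ball z (min e e'))"
      using e(2) by (rule inj_on_subset) auto
    then show ?thesis
      using e e' by (intro exI[of _ "min e e'"]) auto
  qed
  have eq: "{z \<in> A \<inter> rat_dom q. harm_shift p q \<eta> z = 0} = {z \<in> S. harm_map p q z = \<eta>}"
    if "\<eta> \<in> T" for \<eta>
    using zeros[OF that] assms(1) \<open>S \<subseteq> A\<close> by (auto simp: harm_shift_def)
  have "finite {z \<in> S. harm_map p q z = \<eta>}" if "\<eta> \<in> T" for \<eta>
    using cont inj assms(3,4) that that by (rule card_fibre_constant(1))
  moreover have "card {z \<in> S. harm_map p q z = a} = card {z \<in> S. harm_map p q z = b}"
    using cont inj assms(3-6) by (rule card_fibre_constant(2))
  ultimately show ?thesis
    using eq \<open>a \<in> T\<close> \<open>b \<in> T\<close> by (simp add: num_zeros_def)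
qed

theorem theorem3p5:
  fixes p q :: "complex poly"
    and \<eta>1 \<eta>2 :: complex
    and \<psi> :: "real \<Rightarrow> complex"
  assumes "q \<noteq> 0"
    and "coprime p q"
    and "rat_degree p q \<ge> 2"
    and "nondegenerate p q"
    and "filterlim (\<lambda>z. cmod (harm_map p q z)) at_top at_infinity"
    and "continuous_on {0..1} \<psi>"
    and "\<psi> 0 = \<eta>1"
    and "\<psi> 1 = \<eta>2"
    and "\<psi> ` {0..1} \<inter> caustic_points p q = {}"
  shows "(\<forall>A \<in> crit_components p q.
            num_zeros (rat_dom q) (harm_shift p q \<eta>1) A = num_zeros (rat_dom q) (harm_shift p q \<eta>2) A) \<and>
         num_zeros (rat_dom q) (harm_shift p q \<eta>1) UNIV = num_zeros (rat_dom q) (harm_shift p q \<eta>2) UNIV"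
proof -
  define T where "T = \<psi> ` {0..1}"
  let ?C = "crit_set p q" and ?K = "{z \<in> rat_dom q. harm_map p q z \<in> T}"
  have conn: "connected T"
    unfolding T_def using assms(6) by (intro connected_continuous_image) auto
  have "compact T"
    unfolding T_def using assms(6) by (intro compact_continuous_image) auto
  then have K: "compact ?K"
    by (rule compact_harm_map_preimage[OF assms(2,5)])
  have \<eta>: "\<eta>1 \<in> T" "\<eta>2 \<in> T"
    using assms(7,8) unfolding T_def by force+
  \<comment> \<open>A critical point over \<open>T\<close> would put a caustic point on the
    path.\<close>
  have KC: "z \<notin> ?C" if "harm_map p q z \<in> T" for z
    using that assms(9) unfolding T_def caustic_points_def by blast
  have "num_zeros (rat_dom q) (harm_shift p q \<eta>1) A = num_zeros (rat_dom q) (harm_shift p q \<eta>2) A"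
    if A: "A \<in> crit_components p q" for A
  proof (rule num_zeros_harm_shift_eq[OF _ _ _ conn \<eta>])
    \<comment> \<open>The component may contain poles, where \<open>harm_map\<close> has only a
      spurious value; they are removed.\<close>
    let ?S = "A \<inter> (rat_dom q - ?C)"
    have comp: "A \<in> components (UNIV - ?C)"
      using A by (simp add: crit_components_def)
    show "?S \<subseteq> rat_dom q - ?C" "?S \<subseteq> A" by auto
    show "open ?S"
      unfolding open_contains_ball
    proof
      fix z assume z: "z \<in> ?S"
      then obtain e where e: "e > 0" "ball z e \<subseteq> rat_dom q - ?C"
        using open_rat_dom_minus_crit open_contains_ball by blast
      \<comment> \<open>The ball is connected, misses the critical set and meets \<open>A\<close>,
        so it stays in this component.\<close>
      moreover have "ball z e \<subseteq> A"
        using z e by (intro components_maximal[OF comp]) auto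
      ultimately show "\<exists>e>0. ball z e \<subseteq> ?S" by blast
    qed
    \<comment> \<open>\<open>A\<close> is closed only relative to the complement of
      \<open>?C\<close>. Since \<open>?K\<close> misses \<open>?C\<close>, cutting \<open>?K\<close>
      with \<open>A\<close> amounts to cutting it with the closed set \<open>Y\<close>.\<close>
    obtain Y where Y: "closed Y" "A = (UNIV - ?C) \<inter> Y"
      using closedin_component[OF comp] by (auto simp: closedin_closed)
    have "{z \<in> ?S. harm_map p q z \<in> T} = ?K \<inter> Y"
      using Y KC by auto
    then show "compact {z \<in> ?S. harm_map p q z \<in> T}"
      using K Y by (simp add: compact_Int_closed)
    show "z \<in> ?S" if "\<eta> \<in> T" "z \<in> A \<inter> rat_dom q" "harm_map p q z = \<eta>" for \<eta> z
      using that KC by auto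
  qed
  moreover have "num_zeros (rat_dom q) (harm_shift p q \<eta>1) UNIV =
    num_zeros (rat_dom q) (harm_shift p q \<eta>2) UNIV"
  proof (rule num_zeros_harm_shift_eq[OF order_refl open_rat_dom_minus_crit _ conn \<eta>])
    have "{z \<in> rat_dom q - ?C. harm_map p q z \<in> T} = ?K"
      using KC by auto
    then show "compact {z \<in> rat_dom q - ?C. harm_map p q z \<in> T}"
      using K by simp
  qed (use KC in auto)
  ultimately show ?thesis by blast
qed

end
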